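(* Let $G$ be a countable group which acts on a discrete bounded geometry metric space $X$ by coarse equivalences. If $G$ is amenable and $X$ has Property A, then $X_G$ has Property A.
   Context: Large scale structures. For families of subsets of $X$, $\mathrm{st}(\mathcal{B},\mathcal{U})=\{\mathrm{st}(B,\mathcal{U})\mid B\in\mathcal{B}\}$, where $\mathrm{st}(B,\mathcal{U})$ is the union of the elements of $\mathcal{U}$ that intersect $B$. A large scale structure on a set $X$ is a nonempty set of families of subsets of $X$ (the uniformly bounded families) such that (1) if $\mathcal{B}_1$ is uniformly bounded and each element of $\mathcal{B}_2$ with more than one point is contained in some element of $\mathcal{B}_1$, then $\mathcal{B}_2$ is uniformly bounded; (2) $\mathrm{st}(\mathcal{B}_1,\mathcal{B}_2)$ is uniformly bounded whenever $\mathcal{B}_1,\mathcal{B}_2$ are. A metric $d$ induces the large scale structure whose uniformly bounded families are those $\mathcal{U}$ with $\sup_{U\in\mathcal{U}}\mathrm{diam}(U)<\infty$. A metric space has bounded geometry if for every $R>0$ there is an integer $N$ such that every $R$-ball has at most $N$ elements. A group $G$ acts on a metric space $X$ by coarse equivalences if it acts on the underlying set and for every $g\in G$ and $R>0$ there is $S>0$ with $d(x,y)\le R\Rightarrow d(gx,gy)\le S$. $X_G$ denotes the set $X$ with the smallest large scale structure containing that of $X$ and all families $\{\{x,gx\}\mid x\in X\}$, $g\in G$. (When $G$ is countable and $X$ is a discrete bounded geometry metric space, this structure is induced by a discrete bounded geometry metric on $X_G$.) Property A. For a set $S$, $\Delta(S)$ is the set of formal linear combinations $\sum_{s\in S}a_s\cdot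 s$ with $a_s\in[0,1]$, $a_s=0$ for all but finitely many $s$, and $\sum a_s=1$, with the $\ell^1$ metric. The star of a vertex $s\in S$ is the set of elements of $\Delta(S)$ with $a_s\ne0$. A partition of unity on $X$ is a map $\phi:X\to\Delta(S)$ for some set $S$. A large scale space $X$ is exact if for each uniformly bounded cover $\mathcal{U}$ of $X$ and each $\varepsilon>0$ there is a partition of unity $\phi:X\to\Delta(S)$ such that the inverse images under $\phi$ of stars of vertices form a uniformly bounded cover of $X$ and $\sup_{U\in\mathcal{U}}\mathrm{diam}\,\phi(U)<\varepsilon$. For discrete bounded geometry metric spaces Property A is equivalent to exactness, which is used as the definition of Property A here. *)

theory Defs
  imports "HOL-Analysis.Analysis" "HOL-Algebra.Group_Action"
begin

section \<open>Large scale structures\<close>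

definition star_set :: "'a set \<Rightarrow> 'a set set \<Rightarrow> 'a set" where
  "star_set B \<U> = \<Union>{U \<in> \<U>. U \<inter> B \<noteq> {}}"

definition star_family :: "'a set set \<Rightarrow> 'a set set \<Rightarrow> 'a set set" where
  "star_family \<B> \<U> = (\<lambda>B. star_set B \<U>) ` \<B>"

definition large_scale_structure :: "'a set \<Rightarrow> 'a set set set \<Rightarrow> bool" where
  "large_scale_structure X L \<longleftrightarrow>
     L \<noteq> {} \<and> (\<forall>\<B>\<in>L. \<B> \<subseteq> Pow X) \<and>
     (\<forall>\<B>\<^sub>1\<in>L. \<forall>\<B>\<^sub>2. \<B>\<^sub>2 \<subseteq> Pow X \<longrightarrow>
        (\<forall>B\<in>\<B>\<^sub>2. (\<exists>x\<in>B. \<exists>y\<in>B. x \<noteq> y) \<longrightarrow> (\<exists>C\<in>\<B>\<^sub>1. B \<subseteq> C)) \<longrightarrow> \<B>\<^sub>2 \<in> L) \<and>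
     (\<forall>\<B>\<^sub>1\<in>L. \<forall>\<B>\<^sub>2\<in>L. star_family \<B>\<^sub>1 \<B>\<^sub>2 \<in> L)"

definition generated_lss :: "'a set \<Rightarrow> 'a set set set \<Rightarrow> 'a set set set" where
  "generated_lss X F = \<Inter>{L. large_scale_structure X L \<and> F \<subseteq> L}"

text \<open>Diameter with respect to a distance function, with values in \<open>[0, \<infinity>]\<close>;
  the diameter of the empty set is \<open>0\<close>.\<close>

definition ediam :: "('a \<Rightarrow> 'a \<Rightarrow> real) \<Rightarrow> 'a set \<Rightarrow> ennreal" where
  "ediam d U = (SUP x\<in>U. SUP y\<in>U. ennreal (d x y))"

definition metric_lss :: "'a set \<Rightarrow> ('a \<Rightarrow> 'a \<Rightarrow> real) \<Rightarrow> 'a set set set" where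
  "metric_lss X d = {\<U>. \<U> \<subseteq> Pow X \<and> (SUP U\<in>\<U>. ediam d U) < \<infinity>}"


section \<open>Discrete metric spaces of bounded geometry\<close>

definition discrete_metric_space :: "'a set \<Rightarrow> ('a \<Rightarrow> 'a \<Rightarrow> real) \<Rightarrow> bool" where
  "discrete_metric_space X d \<longleftrightarrow>
     Metric_space X d \<and> Metric_space.mtopology X d = discrete_topology X"

definition bounded_geometry :: "'a set \<Rightarrow> ('a \<Rightarrow> 'a \<Rightarrow> real) \<Rightarrow> bool" where
  "bounded_geometry X d \<longleftrightarrow>
     (\<forall>R>0. \<exists>N::nat. \<forall>x\<in>X.
        finite (Metric_space.mball X d x R) \<and> card (Metric_space.mball X d x R) \<le> N)"


section \<open>Group actions by coarse equivalences\<close>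

definition acts_by_coarse_equivalences ::
    "('g, 'm) monoid_scheme \<Rightarrow> 'a set \<Rightarrow> ('a \<Rightarrow> 'a \<Rightarrow> real) \<Rightarrow> ('g \<Rightarrow> 'a \<Rightarrow> 'a) \<Rightarrow> bool" where
  "acts_by_coarse_equivalences G X d \<alpha> \<longleftrightarrow>
     group_action G X \<alpha> \<and>
     (\<forall>g\<in>carrier G. \<forall>R>0. \<exists>S>0. \<forall>x\<in>X. \<forall>y\<in>X. d x y \<le> R \<longrightarrow> d (\<alpha> g x) (\<alpha> g y) \<le> S)"

text \<open>\<open>X\<^sub>G\<close> is the set \<open>X\<close> equipped with the structure \<open>quotient_lss\<close>.\<close>

definition quotient_lss ::
    "('g, 'm) monoid_scheme \<Rightarrow> 'a set \<Rightarrow> ('a \<Rightarrow> 'a \<Rightarrow> real) \<Rightarrow> ('g \<Rightarrow> 'a \<Rightarrow> 'a) \<Rightarrow> 'a set set set" where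
  "quotient_lss G X d \<alpha> =
     generated_lss X (metric_lss X d \<union> (\<lambda>g. (\<lambda>x. {x, \<alpha> g x}) ` X) ` carrier G)"

text \<open>Amenability in von Neumann's sense: a left invariant finitely additive probability
  measure defined on all subsets of the (discrete) group.\<close>

definition amenable :: "('g, 'm) monoid_scheme \<Rightarrow> bool" where
  "amenable G \<longleftrightarrow> group G \<and>
     (\<exists>\<mu> :: 'g set \<Rightarrow> real.
        (\<forall>A. A \<subseteq> carrier G \<longrightarrow> 0 \<le> \<mu> A) \<and>
        \<mu> (carrier G) = 1 \<and>
        (\<forall>A B. A \<subseteq> carrier G \<longrightarrow> B \<subseteq> carrier G \<longrightarrow> A \<inter> B = {} \<longrightarrow> \<mu> (A \<union> B) = \<mu> A + \<mu> B) \<and>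
        (\<forall>g\<in>carrier G. \<forall>A. A \<subseteq> carrier G \<longrightarrow> \<mu> (g <#\<^bsub>G\<^esub> A) = \<mu> A))"


section \<open>Exactness (Property A)\<close>

text \<open>A formal linear combination is represented by its coefficient function, which vanishes
  outside \<open>S\<close>.\<close>

definition simplices :: "'s set \<Rightarrow> ('s \<Rightarrow> real) set" where
  "simplices S = {a. (\<forall>s. 0 \<le> a s \<and> a s \<le> 1) \<and> finite {s. a s \<noteq> 0} \<and> {s. a s \<noteq> 0} \<subseteq> S \<and>
                     (\<Sum>s\<in>{s. a s \<noteq> 0}. a s) = 1}"

definition l1_dist :: "('s \<Rightarrow> real) \<Rightarrow> ('s \<Rightarrow> real) \<Rightarrow> real" where
  "l1_dist a b = (\<Sum>s\<in>{s. a s \<noteq> 0 \<or> b s \<noteq> 0}. \<bar>a s - b s\<bar>)"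

definition vertex_star :: "'s set \<Rightarrow> 's \<Rightarrow> ('s \<Rightarrow> real) set" where
  "vertex_star S s = {a \<in> simplices S. a s \<noteq> 0}"

definition uniformly_bounded_cover :: "'a set \<Rightarrow> 'a set set set \<Rightarrow> 'a set set \<Rightarrow> bool" where
  "uniformly_bounded_cover X L \<U> \<longleftrightarrow> \<U> \<in> L \<and> \<Union>\<U> = X"

definition exact_partition ::
    "'a set \<Rightarrow> 'a set set set \<Rightarrow> 'a set set \<Rightarrow> real \<Rightarrow> 's set \<Rightarrow> ('a \<Rightarrow> 's \<Rightarrow> real) \<Rightarrow> bool" where
  "exact_partition X L \<U> \<epsilon> S \<phi> \<longleftrightarrow>
     \<phi> \<in> X \<rightarrow> simplices S \<and>
     uniformly_bounded_cover X L ((\<lambda>s. {x \<in> X. \<phi> x \<in> vertex_star S s}) ` S) \<and>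
     (SUP U\<in>\<U>. ediam l1_dist (\<phi> ` U)) < ennreal \<epsilon>"

text \<open>The vertex set may be an arbitrary set. As a quantifier over all types is not available,
  vertices are taken in \<open>'a \<times> nat\<close>; this loses nothing because each point only involves finitely
  many vertices, see \<open>exact_partition_reindex\<close> below.\<close>

definition exact :: "'a set \<Rightarrow> 'a set set set \<Rightarrow> bool" where
  "exact X L \<longleftrightarrow>
     (\<forall>\<U> \<epsilon>. uniformly_bounded_cover X L \<U> \<longrightarrow> \<epsilon> > 0 \<longrightarrow>
        (\<exists>(S :: ('a \<times> nat) set) \<phi>. exact_partition X L \<U> \<epsilon> S \<phi>))"

abbreviation property_A :: "'a set \<Rightarrow> 'a set set set \<Rightarrow> bool" where
  "property_A \<equiv> exact"


section \<open>Basic facts\<close>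

lemma SUP_ediam_finite_iff:
  "(SUP U\<in>\<U>. ediam d U) < \<infinity> \<longleftrightarrow> (\<exists>R. \<forall>U\<in>\<U>. \<forall>x\<in>U. \<forall>y\<in>U. d x y \<le> R)"
proof
  assume "(SUP U\<in>\<U>. ediam d U) < \<infinity>"
  then obtain r where r: "r \<ge> 0" "(SUP U\<in>\<U>. ediam d U) = ennreal r"
    by (cases "SUP U\<in>\<U>. ediam d U") auto
  have "d x y \<le> r" if "U \<in> \<U>" "x \<in> U" "y \<in> U" for U x y
  proof -
    have "ennreal (d x y) \<le> (SUP y\<in>U. ennreal (d x y))" by (rule SUP_upper[OF that(3)])
    also have "\<dots> \<le> ediam d U" unfolding ediam_def by (rule SUP_upper[OF that(2)])
    also have "\<dots> \<le> ennreal r" using SUP_upper[OF that(1), of "ediam d"] r by simp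
    finally show ?thesis using r(1) by (simp add: ennreal_le_iff)
  qed
  then show "\<exists>R. \<forall>U\<in>\<U>. \<forall>x\<in>U. \<forall>y\<in>U. d x y \<le> R" by blast
next
  assume "\<exists>R. \<forall>U\<in>\<U>. \<forall>x\<in>U. \<forall>y\<in>U. d x y \<le> R"
  then obtain R where R: "\<forall>U\<in>\<U>. \<forall>x\<in>U. \<forall>y\<in>U. d x y \<le> R" by blast
  then have "(SUP U\<in>\<U>. ediam d U) \<le> ennreal R"
    unfolding ediam_def by (auto intro!: SUP_least ennreal_leI)
  then show "(SUP U\<in>\<U>. ediam d U) < \<infinity>"
    using ennreal_less_top le_less_trans by fastforce
qed

lemma large_scale_structure_metric_lss:
  assumes "Metric_space X d"
  shows "large_scale_structure X (metric_lss X d)"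
proof -
  interpret Metric_space X d by fact
  let ?bd = "\<lambda>\<U> R. \<forall>U\<in>\<U>. \<forall>x\<in>U. \<forall>y\<in>U. d x y \<le> R"
  have mem: "\<U> \<in> metric_lss X d \<longleftrightarrow> \<U> \<subseteq> Pow X \<and> (\<exists>R. ?bd \<U> R)" for \<U>
    unfolding metric_lss_def mem_Collect_eq SUP_ediam_finite_iff ..
  have 1: "\<B>\<^sub>2 \<in> metric_lss X d"
    if B1: "\<B>\<^sub>1 \<in> metric_lss X d" and B2: "\<B>\<^sub>2 \<subseteq> Pow X"
      and sub: "\<forall>B\<in>\<B>\<^sub>2. (\<exists>x\<in>B. \<exists>y\<in>B. x \<noteq> y) \<longrightarrow> (\<exists>C\<in>\<B>\<^sub>1. B \<subseteq> C)" for \<B>\<^sub>1 \<B>\<^sub>2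
  proof -
    from B1 obtain R where R: "?bd \<B>\<^sub>1 R" unfolding mem by (elim conjE exE)
    have "d x y \<le> max R 0" if *: "B \<in> \<B>\<^sub>2" "x \<in> B" "y \<in> B" for B x y
    proof (cases "x = y")
      case True
      have "x \<in> X" using * B2 by blast
      then show ?thesis using True by simp
    next
      case False
      then obtain C where "C \<in> \<B>\<^sub>1" "B \<subseteq> C" using * sub by blast
      then have "d x y \<le> R" using R * by blast
      then show ?thesis by simp
    qed
    then have "?bd \<B>\<^sub>2 (max R 0)" by blast
    then show ?thesis unfolding mem using B2 by (intro conjI exI)
  qed
  have 2: "star_family \<B>\<^sub>1 \<B>\<^sub>2 \<in> metric_lss X d"
    if B1: "\<B>\<^sub>1 \<in> metric_lss X d" and B2: "\<B>\<^sub>2 \<in> metric_lss X d" for \<B>\<^sub>1 \<B>\<^sub>2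
  proof -
    from B1 B2 obtain R1 R2 where R: "?bd \<B>\<^sub>1 R1" "?bd \<B>\<^sub>2 R2"
      and sub: "\<B>\<^sub>1 \<subseteq> Pow X" "\<B>\<^sub>2 \<subseteq> Pow X"
      unfolding mem by (elim conjE exE)
    have "d x y \<le> R2 + (R1 + R2)"
      if *: "B \<in> \<B>\<^sub>1" "x \<in> star_set B \<B>\<^sub>2" "y \<in> star_set B \<B>\<^sub>2" for B x y
    proof -
      obtain U u where U: "U \<in> \<B>\<^sub>2" "x \<in> U" "u \<in> U" "u \<in> B" using * by (auto simp: star_set_def)
      obtain V v where V: "V \<in> \<B>\<^sub>2" "y \<in> V" "v \<in> V" "v \<in> B" using * by (auto simp: star_set_def)
      have X: "x \<in> X" "y \<in> X" "u \<in> X" "v \<in> X" using U V sub by blast+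
      have "d x y \<le> d x u + d u y" using X triangle by blast
      moreover have "d u y \<le> d u v + d v y" using X triangle by blast
      moreover have "d x u \<le> R2" "d u v \<le> R1" "d v y \<le> R2" using U V R *(1) by blast+
      ultimately show ?thesis by linarith
    qed
    then have "?bd (star_family \<B>\<^sub>1 \<B>\<^sub>2) (R2 + (R1 + R2))"
      unfolding star_family_def by blast
    moreover have "star_family \<B>\<^sub>1 \<B>\<^sub>2 \<subseteq> Pow X"
      using sub by (auto simp: star_family_def star_set_def)
    ultimately show ?thesis unfolding mem by (intro conjI exI)
  qed
  have 0: "{} \<in> metric_lss X d" using mem by simp
  show ?thesis
    unfolding large_scale_structure_def
  proof (intro conjI ballI allI impI)
    show "metric_lss X d \<noteq> {}" using 0 by blast
    show "\<B> \<subseteq> Pow X" if "\<B> \<in> metric_lss X d" for \<B> using that unfolding mem by (elim conjE)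
    show "\<B>\<^sub>2 \<in> metric_lss X d"
      if "\<B>\<^sub>1 \<in> metric_lss X d" "\<B>\<^sub>2 \<subseteq> Pow X"
        "\<forall>B\<in>\<B>\<^sub>2. (\<exists>x\<in>B. \<exists>y\<in>B. x \<noteq> y) \<longrightarrow> (\<exists>C\<in>\<B>\<^sub>1. B \<subseteq> C)" for \<B>\<^sub>1 \<B>\<^sub>2
      using that by (rule 1)
    show "star_family \<B>\<^sub>1 \<B>\<^sub>2 \<in> metric_lss X d"
      if "\<B>\<^sub>1 \<in> metric_lss X d" "\<B>\<^sub>2 \<in> metric_lss X d" for \<B>\<^sub>1 \<B>\<^sub>2
      using that by (rule 2)
  qed
qed

lemma large_scale_structure_all: "large_scale_structure X (Pow (Pow X))"
proof -
  have "star_family \<B>\<^sub>1 \<B>\<^sub>2 \<in> Pow (Pow X)" if "\<B>\<^sub>2 \<in> Pow (Pow X)" for \<B>\<^sub>1 \<B>\<^sub>2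
    using that by (auto simp: star_family_def star_set_def)
  then show ?thesis unfolding large_scale_structure_def
    by (intro conjI ballI allI impI) auto
qed

lemma large_scale_structureD:
  assumes "large_scale_structure X L"
  shows "L \<noteq> {}"
    and "\<lbrakk>\<B>\<^sub>1 \<in> L; \<B>\<^sub>2 \<subseteq> Pow X;
          \<forall>B\<in>\<B>\<^sub>2. (\<exists>x\<in>B. \<exists>y\<in>B. x \<noteq> y) \<longrightarrow> (\<exists>C\<in>\<B>\<^sub>1. B \<subseteq> C)\<rbrakk> \<Longrightarrow> \<B>\<^sub>2 \<in> L"
    and "\<lbrakk>\<B>\<^sub>1 \<in> L; \<B>\<^sub>2 \<in> L\<rbrakk> \<Longrightarrow> star_family \<B>\<^sub>1 \<B>\<^sub>2 \<in> L"
proof -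
  note * = assms[unfolded large_scale_structure_def]
  show "L \<noteq> {}" using * by (rule conjunct1)
  show "\<B>\<^sub>2 \<in> L" if "\<B>\<^sub>1 \<in> L" "\<B>\<^sub>2 \<subseteq> Pow X"
      "\<forall>B\<in>\<B>\<^sub>2. (\<exists>x\<in>B. \<exists>y\<in>B. x \<noteq> y) \<longrightarrow> (\<exists>C\<in>\<B>\<^sub>1. B \<subseteq> C)"
    by (rule *[THEN conjunct2, THEN conjunct2, THEN conjunct1, THEN bspec, THEN spec,
          THEN mp, THEN mp]) (fact that)+
  show "star_family \<B>\<^sub>1 \<B>\<^sub>2 \<in> L" if "\<B>\<^sub>1 \<in> L" "\<B>\<^sub>2 \<in> L"
    by (rule *[THEN conjunct2, THEN conjunct2, THEN conjunct2, THEN bspec, THEN bspec])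
      (fact that)+
qed

lemma large_scale_structure_empty_family:
  assumes "large_scale_structure X L"
  shows "{} \<in> L"
proof -
  obtain \<B> where "\<B> \<in> L" using large_scale_structureD(1)[OF assms] by auto
  then show ?thesis by (rule large_scale_structureD(2)[OF assms]) simp_all
qed

lemma large_scale_structure_generated_lss:
  assumes "F \<subseteq> Pow (Pow X)"
  shows "large_scale_structure X (generated_lss X F)" and "F \<subseteq> generated_lss X F"
    and "\<And>L. large_scale_structure X L \<Longrightarrow> F \<subseteq> L \<Longrightarrow> generated_lss X F \<subseteq> L"
proof -
  let ?I = "generated_lss X F"
  show "F \<subseteq> ?I" by (auto simp: generated_lss_def)
  show le: "?I \<subseteq> L" if "large_scale_structure X L" "F \<subseteq> L" for L
    using that by (auto simp: generated_lss_def)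
  have I: "\<B> \<in> ?I \<longleftrightarrow> (\<forall>L. large_scale_structure X L \<longrightarrow> F \<subseteq> L \<longrightarrow> \<B> \<in> L)" for \<B>
    by (auto simp: generated_lss_def)
  show "large_scale_structure X ?I"
    unfolding large_scale_structure_def
  proof (intro conjI ballI allI impI)
    show "?I \<noteq> {}" using I large_scale_structure_empty_family by blast
  next
    fix \<B> assume "\<B> \<in> ?I"
    then show "\<B> \<subseteq> Pow X" using le[OF large_scale_structure_all assms] by blast
  next
    fix \<B>\<^sub>1 \<B>\<^sub>2 assume *: "\<B>\<^sub>1 \<in> ?I" "\<B>\<^sub>2 \<subseteq> Pow X"
      "\<forall>B\<in>\<B>\<^sub>2. (\<exists>x\<in>B. \<exists>y\<in>B. x \<noteq> y) \<longrightarrow> (\<exists>C\<in>\<B>\<^sub>1. B \<subseteq> C)"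
    show "\<B>\<^sub>2 \<in> ?I"
      unfolding I
    proof (intro allI impI)
      fix L assume L: "large_scale_structure X L" "F \<subseteq> L"
      then have "\<B>\<^sub>1 \<in> L" using *(1) I by blast
      then show "\<B>\<^sub>2 \<in> L" by (rule large_scale_structureD(2)[OF L(1) _ *(2,3)])
    qed
  next
    fix \<B>\<^sub>1 \<B>\<^sub>2 assume *: "\<B>\<^sub>1 \<in> ?I" "\<B>\<^sub>2 \<in> ?I"
    show "star_family \<B>\<^sub>1 \<B>\<^sub>2 \<in> ?I"
      unfolding I
    proof (intro allI impI)
      fix L assume L: "large_scale_structure X L" "F \<subseteq> L"
      then have "\<B>\<^sub>1 \<in> L" "\<B>\<^sub>2 \<in> L" using * I by blast+
      then show "star_family \<B>\<^sub>1 \<B>\<^sub>2 \<in> L" by (rule large_scale_structureD(3)[OF L(1)])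
    qed
  qed
qed

lemma exact_partition_reindex:
  fixes S :: "'s set" and X :: "'a set" and \<phi> :: "'a \<Rightarrow> 's \<Rightarrow> real"
  assumes L: "large_scale_structure X L" and U: "uniformly_bounded_cover X L \<U>"
    and part: "exact_partition X L \<U> \<epsilon> S \<phi>"
  shows "\<exists>(S' :: ('a \<times> nat) set) \<phi>'. exact_partition X L \<U> \<epsilon> S' \<phi>'"
proof -
  define T where "T = {s. \<exists>x\<in>X. \<phi> x s \<noteq> 0}"
  have \<phi>: "\<phi> x \<in> simplices S" if "x \<in> X" for x
    using part that by (auto simp: exact_partition_def)
  have fin: "finite {s. \<phi> x s \<noteq> 0}" if "x \<in> X" for x
    using \<phi>[OF that] by (simp add: simplices_def)
  have TS: "T \<subseteq> S" using \<phi> unfolding T_def simplices_def by blast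
  have "\<forall>s\<in>T. \<exists>x. x \<in> X \<and> \<phi> x s \<noteq> 0" by (auto simp: T_def)
  then obtain p where p: "\<And>s. s \<in> T \<Longrightarrow> p s \<in> X \<and> \<phi> (p s) s \<noteq> 0" by metis
  have "\<forall>x\<in>X. \<exists>f :: 's \<Rightarrow> nat. inj_on f {s. \<phi> x s \<noteq> 0}"
    using fin finite_imp_inj_to_nat_seg by blast
  then obtain k :: "'a \<Rightarrow> 's \<Rightarrow> nat" where k: "\<And>x. x \<in> X \<Longrightarrow> inj_on (k x) {s. \<phi> x s \<noteq> 0}"
    by metis
  define e where "e s = (p s, k (p s) s)" for s
  have e: "inj_on e T"
  proof (rule inj_onI)
    fix s t assume "s \<in> T" "t \<in> T" "e s = e t"
    then have "p t = p s" "k (p s) s = k (p s) t" by (auto simp: e_def)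
    then show "s = t"
      using k[of "p s"] p[OF \<open>s \<in> T\<close>] p[OF \<open>t \<in> T\<close>] by (auto dest: inj_onD)
  qed
  define \<psi> where "\<psi> x v = (if v \<in> e ` T then \<phi> x (the_inv_into T e v) else 0)" for x v
  have \<psi>e: "\<psi> x (e s) = \<phi> x s" if "s \<in> T" for x s
    using that e by (simp add: \<psi>_def the_inv_into_f_f)
  have \<psi>0: "\<psi> x v = 0" if "v \<notin> e ` T" for x v using that by (simp add: \<psi>_def)
  have supp: "{v. \<psi> x v \<noteq> 0} = e ` {s. \<phi> x s \<noteq> 0}" if "x \<in> X" for x
  proof -
    have "{s. \<phi> x s \<noteq> 0} \<subseteq> T" using that by (auto simp: T_def)
    then show ?thesis using \<psi>e \<psi>0 by (auto simp: image_iff) (metis \<psi>e)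
  qed
  have inj: "inj_on e {s. \<phi> x s \<noteq> 0}" if "x \<in> X" for x
    by (rule inj_on_subset[OF e]) (use that in \<open>auto simp: T_def\<close>)
  have simp: "\<psi> x \<in> simplices (e ` T)" if x: "x \<in> X" for x
  proof -
    have a: "0 \<le> \<psi> x v \<and> \<psi> x v \<le> 1" for v
      using \<phi>[OF x] by (simp add: \<psi>_def simplices_def)
    have b: "{s. \<phi> x s \<noteq> 0} \<subseteq> T" using x by (auto simp: T_def)
    have "(\<Sum>v\<in>{v. \<psi> x v \<noteq> 0}. \<psi> x v) = (\<Sum>s\<in>{s. \<phi> x s \<noteq> 0}. \<psi> x (e s))"
      unfolding supp[OF x] by (simp add: sum.reindex[OF inj[OF x]])
    also have "\<dots> = (\<Sum>s\<in>{s. \<phi> x s \<noteq> 0}. \<phi> x s)"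
      by (rule sum.cong) (use b \<psi>e in auto)
    also have "\<dots> = 1" using \<phi>[OF x] by (simp add: simplices_def)
    finally show ?thesis using a b fin[OF x] supp[OF x] by (auto simp: simplices_def)
  qed
  have dist: "l1_dist (\<psi> x) (\<psi> y) = l1_dist (\<phi> x) (\<phi> y)" if x: "x \<in> X" and y: "y \<in> X" for x y
  proof -
    let ?D = "{s. \<phi> x s \<noteq> 0 \<or> \<phi> y s \<noteq> 0}"
    have D: "?D \<subseteq> T" using x y by (auto simp: T_def)
    have "{v. \<psi> x v \<noteq> 0 \<or> \<psi> y v \<noteq> 0} = e ` ?D"
      by (simp only: Collect_disj_eq image_Un supp[OF x] supp[OF y])
    then have "l1_dist (\<psi> x) (\<psi> y) = (\<Sum>s\<in>?D. \<bar>\<psi> x (e s) - \<psi> y (e s)\<bar>)"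
      unfolding l1_dist_def by (simp only: sum.reindex[OF inj_on_subset[OF e D]] comp_def)
    also have "\<dots> = l1_dist (\<phi> x) (\<phi> y)"
      unfolding l1_dist_def by (rule sum.cong) (use D \<psi>e in auto)
    finally show ?thesis .
  qed
  let ?star = "\<lambda>s. {x \<in> X. \<phi> x \<in> vertex_star S s}"
  let ?star' = "\<lambda>v. {x \<in> X. \<psi> x \<in> vertex_star (e ` T) v}"
  have st: "?star' (e s) = ?star s" if "s \<in> T" for s
    using \<phi> simp \<psi>e[OF that] by (auto simp: vertex_star_def)
  have fam: "?star' ` (e ` T) = ?star ` T" unfolding image_image using st by simp
  have cov: "?star ` S \<in> L" "\<Union>(?star ` S) = X"
    using part by (auto simp: exact_partition_def uniformly_bounded_cover_def)
  have "?star ` T \<subseteq> Pow X" by auto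
  moreover have "\<forall>B \<in> ?star ` T. (\<exists>x\<in>B. \<exists>y\<in>B. x \<noteq> y) \<longrightarrow> (\<exists>C\<in>?star ` S. B \<subseteq> C)"
    using TS by blast
  ultimately have mem: "?star ` T \<in> L"
    by (rule large_scale_structureD(2)[OF L cov(1)])
  have "X \<subseteq> \<Union>(?star ` T)"
  proof
    fix x assume x: "x \<in> X"
    then obtain s where "s \<in> S" "x \<in> ?star s" using cov(2) by blast
    moreover from this have "s \<in> T" by (auto simp: vertex_star_def T_def)
    ultimately show "x \<in> \<Union>(?star ` T)" by blast
  qed
  then have un: "\<Union>(?star ` T) = X" by blast
  have "ediam l1_dist (\<psi> ` V) = ediam l1_dist (\<phi> ` V)" if "V \<in> \<U>" for V
  proof -
    have "V \<subseteq> X" using U that by (auto simp: uniformly_bounded_cover_def)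
    then show ?thesis
      unfolding ediam_def image_image by (intro SUP_cong refl) (use dist in \<open>simp add: subset_iff\<close>)
  qed
  then have "(SUP V\<in>\<U>. ediam l1_dist (\<psi> ` V)) = (SUP V\<in>\<U>. ediam l1_dist (\<phi> ` V))"
    by (rule SUP_cong[OF refl])
  then have "(SUP V\<in>\<U>. ediam l1_dist (\<psi> ` V)) < ennreal \<epsilon>"
    using part by (simp add: exact_partition_def)
  then have "exact_partition X L \<U> \<epsilon> (e ` T) \<psi>"
    unfolding exact_partition_def uniformly_bounded_cover_def fam
    using simp mem un by blast
  then show ?thesis by blast
qed

end

theory Submission
  imports Defs
begin

text \<open>A family is uniformly bounded in \<open>X\<^sub>G\<close> exactly when there are a finite \<open>E \<subseteq> G\<close> and \<open>R\<close> such
  that any two points \<open>x, y\<close> of a common member satisfy \<open>d (g x) y \<le> R\<close> for some \<open>g \<in> E\<close>. Given a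
  finite \<open>F \<subseteq> G\<close> that is almost invariant under left translation by \<open>E\<inverse>\<close>, and a partition of unity
  \<open>\<psi>\<close> on \<open>X\<close> with small variation on the scale of all \<open>h\<inverse>\<close>-images (\<open>h \<in> F\<close>) of \<open>R\<close>-close pairs, the
  average \<open>\<phi> x = 1/|F| \<Sum>h\<in>F. \<psi> (h\<inverse> x)\<close> varies little along both \<open>x \<mapsto> g x\<close> and \<open>R\<close>-close pairs,
  and its stars lie in the unions of the \<open>F\<close>-translates of the stars of \<open>\<psi>\<close>.

  The almost invariant sets come from the invariant measure by Tarski's argument: without them some
  finite \<open>S\<close> satisfies \<open>|S F| \<ge> 2 |F|\<close> for all finite \<open>F\<close>, so Hall's theorem gives an injection
  \<open>G \<times> {0, 1} \<rightarrow> G\<close> moving points by elements of \<open>S\<close> only, and the measure of \<open>G\<close> would be at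
  least \<open>2\<close>.\<close>

section \<open>Hall's marriage theorem for arbitrary families of finite sets\<close>

text \<open>Rado's proof: in a minimal relation satisfying Hall's condition every point has just one
  partner, as otherwise deleting either of two partners would violate the condition on finite sets
  \<open>J\<close> and \<open>K\<close>, contradicting submodularity of the cardinality of neighbourhoods.\<close>

lemma hall_injection:
  assumes fin: "\<And>i. i \<in> I \<Longrightarrow> finite (R `` {i})"
    and hall: "\<And>J. finite J \<Longrightarrow> J \<subseteq> I \<Longrightarrow> card J \<le> card (R `` J)"
  shows "\<exists>f. inj_on f I \<and> (\<forall>i\<in>I. (i, f i) \<in> R)"
proof -
  define hl where "hl M \<longleftrightarrow> (\<forall>J. finite J \<longrightarrow> J \<subseteq> I \<longrightarrow> card J \<le> card (M `` J))" for M :: "('a \<times> 'b) set"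
  \<comment> \<open>Zorn's lemma is applied to the deletable sets of pairs: a maximal deletion
    leaves a minimal relation.\<close>
  define \<D> where "\<D> = {D. D \<subseteq> R \<and> hl (R - D)}"
  have finJ: "finite (M `` J)" if "M \<subseteq> R" "finite J" "J \<subseteq> I" for M J
  proof (rule finite_subset)
    show "M `` J \<subseteq> (\<Union>j\<in>J. R `` {j})" using that by auto
    show "finite (\<Union>j\<in>J. R `` {j})" using that fin by auto
  qed
  have "\<exists>D\<in>\<D>. \<forall>E\<in>\<D>. D \<subseteq> E \<longrightarrow> E = D"
  proof (rule subset_Zorn')
    fix \<C> assume ch: "subset.chain \<D> \<C>"
    have sub: "\<C> \<subseteq> \<D>" using ch by (simp add: subset.chain_def)
    show "\<Union>\<C> \<in> \<D>"
    proof (cases "\<C> = {}")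
      case True
      then show ?thesis using hall by (simp add: \<D>_def hl_def)
    next
      case False
      have "card J \<le> card ((R - \<Union>\<C>) `` J)" if J: "finite J" "J \<subseteq> I" for J
      proof -
        \<comment> \<open>Over a finite \<open>J\<close> only finitely many pairs matter, so those
          deleted by the union of the chain are already deleted by a single nonempty stage of
          it.\<close>
        have "finite (J \<times> R `` J)" using J finJ by blast
        then have "finite (\<Union>\<C> \<inter> (J \<times> R `` J))" by blast
        from finite_subset_Union_chain[OF this _ False ch]
        obtain D where D: "D \<in> \<C>" "\<Union>\<C> \<inter> (J \<times> R `` J) \<subseteq> D" by blast
        have "(R - \<Union>\<C>) `` J = (R - D) `` J" using D by blast
        moreover have "hl (R - D)" using D sub by (auto simp: \<D>_def)
        ultimately show ?thesis using J by (simp add: hl_def)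
      qed
      moreover have "\<Union>\<C> \<subseteq> R" using sub by (auto simp: \<D>_def)
      ultimately show ?thesis by (simp add: \<D>_def hl_def)
    qed
  qed
  then obtain D where D: "D \<in> \<D>" and max: "\<And>E. E \<in> \<D> \<Longrightarrow> D \<subseteq> E \<Longrightarrow> E = D" by blast
  define M where "M = R - D"
  have MR: "M \<subseteq> R" by (auto simp: M_def)
  have M: "card J \<le> card (M `` J)" if "finite J" "J \<subseteq> I" for J
    using D that by (simp add: \<D>_def hl_def M_def)
  \<comment> \<open>By minimality no further pair can be deleted. A violating \<open>J\<close> must
    contain \<open>i\<close>, since otherwise the deletion does not affect its neighbours.\<close>
  have viol: "\<exists>J. finite J \<and> J \<subseteq> I \<and> i \<in> J \<and> card ((M - {(i, a)}) `` J) < card J"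
    if "(i, a) \<in> M" for i a
  proof -
    have "insert (i, a) D \<notin> \<D>" using max[of "insert (i, a) D"] that by (auto simp: M_def)
    moreover have "R - insert (i, a) D = M - {(i, a)}" by (auto simp: M_def)
    ultimately have "\<not> hl (M - {(i, a)})" using D that by (auto simp: \<D>_def M_def)
    then obtain J where J: "finite J" "J \<subseteq> I" "card ((M - {(i, a)}) `` J) < card J"
      by (auto simp: hl_def not_le)
    moreover have "i \<in> J"
    proof (rule ccontr)
      assume "i \<notin> J"
      then have "(M - {(i, a)}) `` J = M `` J" by blast
      then show False using M[OF J(1,2)] J(3) by simp
    qed
    ultimately show ?thesis by blast
  qed
  have uniq: "a = b" if ab: "(i, a) \<in> M" "(i, b) \<in> M" for i a b
  proof (rule ccontr)
    assume ne: "a \<noteq> b"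
    obtain J where J: "finite J" "J \<subseteq> I" "i \<in> J" "card ((M - {(i, a)}) `` J) < card J"
      using viol[OF ab(1)] by (elim exE conjE)
    obtain K where K: "finite K" "K \<subseteq> I" "i \<in> K" "card ((M - {(i, b)}) `` K) < card K"
      using viol[OF ab(2)] by (elim exE conjE)
    let ?P = "(M - {(i, a)}) `` J" and ?Q = "(M - {(i, b)}) `` K"
    have fP: "finite ?P" by (rule finJ) (use MR J in auto)
    have fQ: "finite ?Q" by (rule finJ) (use MR K in auto)
    have "card (J \<union> K) \<le> card (M `` (J \<union> K))" by (rule M) (use J K in auto)
    \<comment> \<open>As \<open>a \<noteq> b\<close>, the partner deleted on one side is still
      present on the other.\<close>
    also have "\<dots> \<le> card (?P \<union> ?Q)"
      by (rule card_mono) (use fP fQ J K ne in auto)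
    finally have 1: "card (J \<union> K) \<le> card (?P \<union> ?Q)" .
    \<comment> \<open>Once \<open>i\<close> is removed neither deletion is visible; this costs 1 in
      the lower bound.\<close>
    have "card (J \<inter> K - {i}) \<le> card (M `` (J \<inter> K - {i}))" by (rule M) (use J K in auto)
    also have "\<dots> \<le> card (?P \<inter> ?Q)"
      by (rule card_mono) (use fP fQ J K ne in auto)
    finally have 2: "card (J \<inter> K) - 1 \<le> card (?P \<inter> ?Q)" using J K by simp
    \<comment> \<open>The two bounds force
      \<open>card ?P + card ?Q \<ge> card J + card K - 1\<close>, whereas the violations allow at
      most \<open>card J + card K - 2\<close>.\<close>
    have "card ?P + card ?Q = card (?P \<union> ?Q) + card (?P \<inter> ?Q)" by (rule card_Un_Int[OF fP fQ])
    moreover have "card J + card K = card (J \<union> K) + card (J \<inter> K)" by (rule card_Un_Int[OF J(1) K(1)])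
    moreover have "card (J \<inter> K) > 0" using J K by (auto simp: card_gt_0_iff)
    ultimately show False using 1 2 J(4) K(4) by linarith
  qed
  have ex: "\<exists>a. (i, a) \<in> M" if "i \<in> I" for i
  proof -
    have "card (M `` {i}) \<noteq> 0" using M[of "{i}"] that by auto
    then have "M `` {i} \<noteq> {}" by fastforce
    then show ?thesis by blast
  qed
  define f where "f i = (SOME a. (i, a) \<in> M)" for i
  have f: "(i, f i) \<in> M" if "i \<in> I" for i
    unfolding f_def using ex[OF that] by (rule someI_ex)
  have "inj_on f I"
  proof (rule inj_onI, rule ccontr)
    fix i j assume ij: "i \<in> I" "j \<in> I" "f i = f j" "i \<noteq> j"
    \<comment> \<open>Single-valuedness leaves \<open>i\<close> and \<open>j\<close> one common
      neighbour, against Hall's condition for the pair.\<close>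
    have "M `` {i, j} \<subseteq> {f i}" using uniq f ij by fastforce
    from card_mono[OF _ this] have "card (M `` {i, j}) \<le> 1" by simp
    moreover have "card {i, j} \<le> card (M `` {i, j})" by (rule M) (use ij in auto)
    ultimately show False using ij by simp
  qed
  then show ?thesis using f MR by blast
qed

section \<open>From an invariant measure to almost invariant finite sets\<close>

lemma finitely_additive_sum:
  fixes \<mu> :: "'b set \<Rightarrow> real"
  assumes add: "\<And>A B. A \<subseteq> X \<Longrightarrow> B \<subseteq> X \<Longrightarrow> A \<inter> B = {} \<Longrightarrow> \<mu> (A \<union> B) = \<mu> A + \<mu> B"
    and "finite I" "\<And>i. i \<in> I \<Longrightarrow> A i \<subseteq> X" "disjoint_family_on A I"
  shows "\<mu> (\<Union>i\<in>I. A i) = (\<Sum>i\<in>I. \<mu> (A i))"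
  using assms(2-4)
proof (induction I rule: finite_induct)
  case empty
  \<comment> \<open>The empty set is disjoint from itself, so additivity gives it measure 0.\<close>
  show ?case using add[of "{}" "{}"] by simp
next
  case (insert i I)
  have "\<mu> (A i \<union> (\<Union>j\<in>I. A j)) = \<mu> (A i) + \<mu> (\<Union>j\<in>I. A j)"
  proof (rule add)
    show "A i \<subseteq> X" "(\<Union>j\<in>I. A j) \<subseteq> X" using insert.prems(1) by blast+
    show "A i \<inter> (\<Union>j\<in>I. A j) = {}"
      using insert.prems(2) insert.hyps(2) by (simp add: disjoint_family_on_insert)
  qed
  moreover have "\<mu> (\<Union>j\<in>I. A j) = (\<Sum>j\<in>I. \<mu> (A j))"
    using insert by (auto simp: disjoint_family_on_def)
  ultimately show ?case using insert by simp
qed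

lemma (in group) finite_set_mult:
  assumes "finite S" "finite F"
  shows "finite (S <#> F)"
  using assms by (simp add: set_mult_def)

text \<open>Doubling is Hall's condition for matching two copies of the group into one. The
  resulting injection is a left translation on each of finitely many pieces, so invariance and
  finite additivity would force total measure at least 2.\<close>

lemma (in group) amenable_not_doubling:
  assumes am: "amenable G" and S: "finite S" "S \<subseteq> carrier G"
  shows "\<exists>F. finite F \<and> F \<subseteq> carrier G \<and> card (S <#> F) < 2 * card F"
proof (rule ccontr)
  assume "\<not> ?thesis"
  then have dbl: "2 * card F \<le> card (S <#> F)" if "finite F" "F \<subseteq> carrier G" for F
    using that not_le by blast
  obtain \<mu> :: "'a set \<Rightarrow> real" where
    nonneg: "\<And>A. A \<subseteq> carrier G \<Longrightarrow> 0 \<le> \<mu> A" and one: "\<mu> (carrier G) = 1" and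
    add: "\<And>A B. A \<subseteq> carrier G \<Longrightarrow> B \<subseteq> carrier G \<Longrightarrow> A \<inter> B = {} \<Longrightarrow> \<mu> (A \<union> B) = \<mu> A + \<mu> B" and
    inv: "\<And>g A. g \<in> carrier G \<Longrightarrow> A \<subseteq> carrier G \<Longrightarrow> \<mu> (g <#\<^bsub>G\<^esub> A) = \<mu> A"
    using am unfolding amenable_def by (elim conjE exE) blast
  define R where "R = {((x, b), s \<otimes> x) | x (b::bool) s. x \<in> carrier G \<and> s \<in> S}"
  have RJ: "R `` J = S <#> (fst ` J)" if "J \<subseteq> carrier G \<times> UNIV" for J
    using that by (force simp: R_def set_mult_def image_iff)
  have "\<exists>f. inj_on f (carrier G \<times> UNIV) \<and> (\<forall>i\<in>carrier G \<times> UNIV. (i, f i) \<in> R)"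
  proof (rule hall_injection)
    fix i :: "'a \<times> bool" assume "i \<in> carrier G \<times> UNIV"
    then show "finite (R `` {i})" using S by (subst RJ) (auto simp: finite_set_mult)
  next
    fix J :: "('a \<times> bool) set" assume J: "finite J" "J \<subseteq> carrier G \<times> UNIV"
    \<comment> \<open>At most two elements of \<open>J\<close> lie over each group element, so
      doubling of the projection suffices.\<close>
    have "card J \<le> card (fst ` J \<times> (UNIV :: bool set))"
      by (rule card_mono) (use J in \<open>auto simp: image_iff\<close>, force)
    also have "\<dots> = 2 * card (fst ` J)" by (simp add: card_cartesian_product)
    also have "\<dots> \<le> card (R `` J)" unfolding RJ[OF J(2)] by (rule dbl) (use J in auto)
    finally show "card J \<le> card (R `` J)" .
  qed
  then obtain f where inj: "inj_on f (carrier G \<times> UNIV)"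
    and fR: "\<forall>i\<in>carrier G \<times> UNIV. (i, f i) \<in> R"
    by (elim exE conjE)
  have f: "\<exists>s\<in>S. f (x, b) = s \<otimes> x" if "x \<in> carrier G" for x b
    using bspec[OF fR, of "(x, b)"] that by (auto simp: R_def)
  \<comment> \<open>Sorting the points of copy \<open>b\<close> by the translation that
    \<open>f\<close> applies to them partitions the group; right cancellation makes the classes
    disjoint.\<close>
  define P where "P b s = {x \<in> carrier G. f (x, b) = s \<otimes> x}" for b s
  have Pc: "P b s \<subseteq> carrier G" for b s by (auto simp: P_def)
  have P1: "(\<Sum>s\<in>S. \<mu> (P b s)) = 1" for b
  proof -
    have "\<mu> (\<Union>s\<in>S. P b s) = (\<Sum>s\<in>S. \<mu> (P b s))"
    proof (rule finitely_additive_sum[OF add S(1) Pc])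
      show "disjoint_family_on (P b) S"
        using S(2) by (auto simp: disjoint_family_on_def P_def) (metis right_cancel subsetD)
    qed
    moreover have "(\<Union>s\<in>S. P b s) = carrier G" using f by (auto simp: P_def)
    ultimately show ?thesis using one by simp
  qed
  \<comment> \<open>These are the images of the pieces under \<open>f\<close>. Invariance preserves
    their measures, and injectivity of \<open>f\<close> makes them disjoint, also across the two
    copies.\<close>
  define Q where "Q i = snd i <#\<^bsub>G\<^esub> P (fst i) (snd i)" for i
  have Qf: "\<exists>x\<in>carrier G. y = f (x, b) \<and> f (x, b) = s \<otimes> x" if y: "y \<in> Q (b, s)" for y b s
  proof -
    obtain x where "x \<in> P b s" "y = s \<otimes> x" using y by (auto simp: Q_def l_coset_def)
    then show ?thesis by (intro bexI[of _ x]) (simp_all add: P_def)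
  qed
  have Qc: "Q i \<subseteq> carrier G" if "i \<in> UNIV \<times> S" for i
    using that S(2) by (auto simp: Q_def P_def l_coset_def)
  have "\<mu> (\<Union>i\<in>UNIV \<times> S. Q i) = (\<Sum>i\<in>UNIV \<times> S. \<mu> (Q i))"
  proof (rule finitely_additive_sum[OF add _ Qc])
    show "disjoint_family_on Q (UNIV \<times> S)"
      unfolding disjoint_family_on_def
    proof (intro ballI impI, rule ccontr)
      fix i j assume ij: "i \<in> UNIV \<times> S" "j \<in> UNIV \<times> S" "i \<noteq> j" "Q i \<inter> Q j \<noteq> {}"
      obtain b s where i: "i = (b, s)" by (cases i)
      obtain c t where j: "j = (c, t)" by (cases j)
      obtain y where y: "y \<in> Q (b, s)" "y \<in> Q (c, t)" using ij i j by blast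
      obtain x where x: "x \<in> carrier G" "y = f (x, b)" "f (x, b) = s \<otimes> x"
        using Qf[OF y(1)] by (elim bexE conjE)
      obtain z where z: "z \<in> carrier G" "y = f (z, c)" "f (z, c) = t \<otimes> z"
        using Qf[OF y(2)] by (elim bexE conjE)
      have eq: "(x, b) = (z, c)" by (rule inj_onD[OF inj]) (use x z in auto)
      have "s = t" using eq x z i j ij S(2) by (auto simp: subset_iff)
      then show False using eq i j ij by simp
    qed
  qed (use S in auto)
  also have "\<dots> = (\<Sum>i\<in>UNIV \<times> S. \<mu> (P (fst i) (snd i)))"
    by (rule sum.cong) (use S(2) Pc inv in \<open>auto simp: Q_def\<close>)
  also have "\<dots> = (\<Sum>b\<in>UNIV. \<Sum>s\<in>S. \<mu> (P b s))"
    by (simp add: sum.cartesian_product split_def)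
  also have "\<dots> = 2" by (simp add: P1 UNIV_bool)
  finally have two: "\<mu> (\<Union>i\<in>UNIV \<times> S. Q i) = 2" .
  have sub: "(\<Union>i\<in>UNIV \<times> S. Q i) \<subseteq> carrier G" using Qc by blast
  have "\<mu> (carrier G) = \<mu> (\<Union>i\<in>UNIV \<times> S. Q i) + \<mu> (carrier G - (\<Union>i\<in>UNIV \<times> S. Q i))"
    using add[OF sub, of "carrier G - (\<Union>i\<in>UNIV \<times> S. Q i)"] sub by (simp add: Un_absorb1)
  then show False using two one nonneg[of "carrier G - (\<Union>i\<in>UNIV \<times> S. Q i)"] by simp
qed

text \<open>Multiplying repeatedly by \<open>S\<close> cannot enlarge a set by the factor
  \<open>1 + \<epsilon>\<close> every time, since the product set \<open>K n\<close> has some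
  \<open>F\<close> that it does not double. The first factor at which growth is slower yields a set
  with small boundary.\<close>

lemma (in group) amenable_folner:
  assumes am: "amenable G" and E: "finite E" "E \<subseteq> carrier G" and \<epsilon>: "\<epsilon> > 0"
  shows "\<exists>F. finite F \<and> F \<noteq> {} \<and> F \<subseteq> carrier G \<and>
    (\<forall>g\<in>E. real (card ((g <#\<^bsub>G\<^esub> F) - F)) \<le> \<epsilon> * real (card F))"
proof -
  \<comment> \<open>Adding \<open>\<one>\<close> makes each set a subset of its product with
    \<open>S\<close>, so that growth in cardinality measures the boundary.\<close>
  define S where "S = insert \<one> E"
  have S: "finite S" "S \<subseteq> carrier G" "\<one> \<in> S" using E by (auto simp: S_def)
  define K where "K n = (((<#>) S) ^^ n) {\<one>}" for n
  have K0: "K 0 = {\<one>}" and KS: "K (Suc n) = S <#> K n" for n by (simp_all add: K_def)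
  have K: "finite (K n) \<and> K n \<subseteq> carrier G" for n
    by (induction n) (use S in \<open>auto simp: K0 KS finite_set_mult dest: set_mult_closed[THEN subsetD]\<close>)
  \<comment> \<open>With this \<open>n\<close>, growth by \<open>1 + \<epsilon>\<close> at each of
    \<open>n\<close> steps would more than double \<open>F\<close>.\<close>
  obtain n where n: "2 < (1 + \<epsilon>) ^ n" using real_arch_pow[of "1 + \<epsilon>" 2] \<epsilon> by auto
  obtain F where F: "finite F" "F \<subseteq> carrier G" "card (K n <#> F) < 2 * card F"
    using amenable_not_doubling[OF am conjunct1[OF K] conjunct2[OF K], of n] by (elim exE conjE)
  define c where "c k = card (K k <#> F)" for k
  have c0: "c 0 = card F" 
  proof -
    have "{\<one>} <#> F = (\<lambda>x. \<one> \<otimes> x) ` F" by (auto simp: set_mult_def)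
    also have "\<dots> = F" using F(2) by (simp add: subset_iff image_def)
    finally show ?thesis by (simp add: c_def K0)
  qed
  have "\<exists>k<n. real (c (Suc k)) < (1 + \<epsilon>) * real (c k)"
  proof (rule ccontr)
    assume "\<not> ?thesis"
    then have grow: "(1 + \<epsilon>) * real (c k) \<le> real (c (Suc k))" if "k < n" for k
      using that by (meson not_less)
    have "(1 + \<epsilon>) ^ k * real (card F) \<le> real (c k)" if "k \<le> n" for k
      using that
    proof (induction k)
      case (Suc k)
      have "(1 + \<epsilon>) ^ Suc k * real (card F) = (1 + \<epsilon>) * ((1 + \<epsilon>) ^ k * real (card F))" by simp
      also have "\<dots> \<le> (1 + \<epsilon>) * real (c k)"
        by (rule mult_left_mono) (use Suc \<epsilon> in auto)
      also have "\<dots> \<le> real (c (Suc k))" by (rule grow) (use Suc in simp)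
      finally show ?case .
    qed (simp add: c0)
    then have "(1 + \<epsilon>) ^ n * real (card F) \<le> real (c n)" by simp
    moreover have "2 * real (card F) \<le> (1 + \<epsilon>) ^ n * real (card F)"
      by (rule mult_right_mono) (use n in auto)
    ultimately show False using F(3) by (simp add: c_def)
  qed
  then obtain k where k: "real (c (Suc k)) < (1 + \<epsilon>) * real (c k)" by blast
  define H where "H = K k <#> F"
  have H: "finite H" "H \<subseteq> carrier G"
    using K F by (auto simp: H_def finite_set_mult dest: set_mult_closed[THEN subsetD])
  have SH: "S <#> H = K (Suc k) <#> F"
    using K F S by (simp add: H_def KS set_mult_assoc)
  have cH: "card H = c k" "card (S <#> H) = c (Suc k)" unfolding c_def H_def[symmetric] SH by (rule refl)+
  have HS: "H \<subseteq> S <#> H"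
  proof
    fix h assume "h \<in> H"
    then have "h = \<one> \<otimes> h" using H by auto
    then show "h \<in> S <#> H" using S \<open>h \<in> H\<close> by (force simp: set_mult_def)
  qed
  have "real (card ((g <#\<^bsub>G\<^esub> H) - H)) \<le> \<epsilon> * real (card H)" if g: "g \<in> E" for g
  proof -
    have "card ((g <#\<^bsub>G\<^esub> H) - H) \<le> card ((S <#> H) - H)"
      by (rule card_mono) (use g S H in \<open>auto simp: S_def l_coset_def set_mult_def\<close>)
    also have "\<dots> = c (Suc k) - c k" using cH HS H by (simp add: card_Diff_subset)
    finally have "real (card ((g <#\<^bsub>G\<^esub> H) - H)) \<le> real (c (Suc k) - c k)" by simp
    also have "\<dots> = real (c (Suc k)) - real (c k)"
      using card_mono[OF finite_set_mult[OF S(1) H(1)] HS] cH by (simp add: of_nat_diff)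
    also have "\<dots> \<le> \<epsilon> * real (card H)" using k cH by (simp add: algebra_simps)
    finally show ?thesis .
  qed
  \<comment> \<open>An empty \<open>H\<close> would make \<open>c k\<close> zero, and
    \<open>c (Suc k)\<close> cannot be negative.\<close>
  moreover have "H \<noteq> {}" using k cH \<epsilon> by auto
  ultimately show ?thesis using H by blast
qed

section \<open>The simplex with the l1 metric, and averages in it\<close>

lemma mem_metric_lss_iff:
  "\<U> \<in> metric_lss X d \<longleftrightarrow> \<U> \<subseteq> Pow X \<and> (\<exists>R. \<forall>U\<in>\<U>. \<forall>x\<in>U. \<forall>y\<in>U. d x y \<le> R)"
  unfolding metric_lss_def mem_Collect_eq SUP_ediam_finite_iff ..

lemma SUP_ediam_lessD:
  assumes "(SUP U\<in>\<U>. ediam l1_dist (f ` U)) < ennreal \<epsilon>" "U \<in> \<U>" "x \<in> U" "y \<in> U"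
  shows "l1_dist (f x) (f y) < \<epsilon>"
proof -
  have "ennreal (l1_dist (f x) (f y)) \<le> ediam l1_dist (f ` U)"
    unfolding ediam_def image_image by (rule SUP_upper2[OF assms(3)], rule SUP_upper[OF assms(4)])
  also have "\<dots> \<le> (SUP U\<in>\<U>. ediam l1_dist (f ` U))" by (rule SUP_upper[OF assms(2)])
  also have "\<dots> < ennreal \<epsilon>" by fact
  finally show ?thesis by (simp add: l1_dist_def ennreal_less_iff sum_nonneg)
qed

lemma l1_dist_eq_sum:
  assumes "finite T" "\<And>s. a s \<noteq> 0 \<or> b s \<noteq> 0 \<Longrightarrow> s \<in> T"
  shows "l1_dist a b = (\<Sum>s\<in>T. \<bar>a s - b s\<bar>)"
  unfolding l1_dist_def by (rule sum.mono_neutral_left) (use assms in auto)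

lemma l1_dist_triangle:
  assumes "finite {s. a s \<noteq> 0}" "finite {s. b s \<noteq> 0}" "finite {s. c s \<noteq> 0}"
  shows "l1_dist a c \<le> l1_dist a b + l1_dist b c"
proof -
  let ?T = "{s. a s \<noteq> 0} \<union> {s. b s \<noteq> 0} \<union> {s. c s \<noteq> 0}"
  have T: "finite ?T" using assms by simp
  have eq: "l1_dist a c = (\<Sum>s\<in>?T. \<bar>a s - c s\<bar>)" "l1_dist a b = (\<Sum>s\<in>?T. \<bar>a s - b s\<bar>)"
    "l1_dist b c = (\<Sum>s\<in>?T. \<bar>b s - c s\<bar>)"
    by (rule l1_dist_eq_sum[OF T]; blast)+
  show ?thesis unfolding eq sum.distrib[symmetric] by (rule sum_mono) linarith
qed

lemma simplicesD:
  assumes "a \<in> simplices S"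
  shows "0 \<le> a s" "a s \<le> 1" "finite {s. a s \<noteq> 0}" "a s \<noteq> 0 \<Longrightarrow> s \<in> S"
    and "finite T \<Longrightarrow> (\<And>s. a s \<noteq> 0 \<Longrightarrow> s \<in> T) \<Longrightarrow> (\<Sum>s\<in>T. a s) = 1"
proof -
  assume T: "finite T" "\<And>s. a s \<noteq> 0 \<Longrightarrow> s \<in> T"
  have "(\<Sum>s\<in>T. a s) = (\<Sum>s\<in>{s. a s \<noteq> 0}. a s)"
    by (rule sum.mono_neutral_right) (use T in auto)
  then show "(\<Sum>s\<in>T. a s) = 1" using assms by (simp add: simplices_def)
qed (use assms in \<open>auto simp: simplices_def\<close>)

text \<open>The equally weighted barycentre of the points \<open>a h\<close>. Keeping the index set
  as an argument allows one family to be averaged over a set and over its translate.\<close>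

definition average :: "'i set \<Rightarrow> ('i \<Rightarrow> 's \<Rightarrow> real) \<Rightarrow> 's \<Rightarrow> real" where
  "average F a s = (\<Sum>h\<in>F. a h s) / real (card F)"

lemma average_nonzeroD:
  assumes "average F a s \<noteq> 0"
  obtains h where "h \<in> F" "a h s \<noteq> 0"
  using assms unfolding average_def by (metis div_0 sum.neutral)

lemma average_simplices:
  assumes F: "finite F" "F \<noteq> {}" and a: "\<And>h. h \<in> F \<Longrightarrow> a h \<in> simplices S"
  shows "average F a \<in> simplices S"
proof -
  let ?T = "\<Union>h\<in>F. {s. a h s \<noteq> 0}"
  have n: "real (card F) > 0" using F by (simp add: card_gt_0_iff)
  have T: "finite ?T" using F a simplicesD(3) by blast
  have supp: "{s. average F a s \<noteq> 0} \<subseteq> ?T" by (auto elim: average_nonzeroD)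
  have 1: "0 \<le> average F a s" for s
    unfolding average_def using simplicesD(1)[OF a] by (simp add: sum_nonneg)
  have 2: "average F a s \<le> 1" for s
  proof -
    have "(\<Sum>h\<in>F. a h s) \<le> (\<Sum>h\<in>F. 1)" by (rule sum_mono) (use simplicesD(2)[OF a] in auto)
    then show ?thesis using n by (simp add: average_def)
  qed
  have "(\<Sum>s | average F a s \<noteq> 0. average F a s) = (\<Sum>s\<in>?T. average F a s)"
    by (rule sum.mono_neutral_left) (use T supp in auto)
  also have "\<dots> = (\<Sum>h\<in>F. \<Sum>s\<in>?T. a h s) / real (card F)"
    unfolding average_def sum_divide_distrib[symmetric] by (subst sum.swap) simp
  also have "(\<Sum>h\<in>F. \<Sum>s\<in>?T. a h s) = (\<Sum>h\<in>F. 1)"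
    by (rule sum.cong[OF refl], rule simplicesD(5)[OF a]) (use T in auto)
  finally have 3: "(\<Sum>s | average F a s \<noteq> 0. average F a s) = 1" using n by simp
  have "?T \<subseteq> S" using simplicesD(4)[OF a] by blast
  then show ?thesis
    using 1 2 3 supp finite_subset[OF supp T] by (simp add: simplices_def)
qed

text \<open>Convexity of the norm: the triangle inequality holds coordinatewise, and over the finite
  set \<open>?T\<close>, which carries all supports, the two summations can be exchanged.\<close>

lemma l1_dist_average_le:
  assumes F: "finite F" and a: "\<And>h. h \<in> F \<Longrightarrow> a h \<in> simplices S"
    and b: "\<And>h. h \<in> F \<Longrightarrow> b h \<in> simplices S"
  shows "l1_dist (average F a) (average F b) \<le> (\<Sum>h\<in>F. l1_dist (a h) (b h)) / real (card F)"
proof -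
  let ?T = "\<Union>h\<in>F. {s. a h s \<noteq> 0} \<union> {s. b h s \<noteq> 0}"
  have T: "finite ?T" using F simplicesD(3)[OF a] simplicesD(3)[OF b] by blast
  have "l1_dist (average F a) (average F b) = (\<Sum>s\<in>?T. \<bar>average F a s - average F b s\<bar>)"
    by (rule l1_dist_eq_sum[OF T]) (blast elim: average_nonzeroD)
  also have "\<dots> \<le> (\<Sum>s\<in>?T. (\<Sum>h\<in>F. \<bar>a h s - b h s\<bar>) / real (card F))"
  proof (rule sum_mono)
    fix s
    have "average F a s - average F b s = (\<Sum>h\<in>F. a h s - b h s) / real (card F)"
      by (simp add: average_def sum_subtractf diff_divide_distrib)
    then show "\<bar>average F a s - average F b s\<bar> \<le> (\<Sum>h\<in>F. \<bar>a h s - b h s\<bar>) / real (card F)"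
      by (simp add: abs_divide divide_right_mono)
  qed
  also have "\<dots> = (\<Sum>h\<in>F. \<Sum>s\<in>?T. \<bar>a h s - b h s\<bar>) / real (card F)"
    unfolding sum_divide_distrib[symmetric] by (subst sum.swap) simp
  also have "(\<Sum>h\<in>F. \<Sum>s\<in>?T. \<bar>a h s - b h s\<bar>) = (\<Sum>h\<in>F. l1_dist (a h) (b h))"
    by (rule sum.cong[OF refl], rule l1_dist_eq_sum[OF T, symmetric]) blast
  finally show ?thesis .
qed

text \<open>The terms over \<open>F \<inter> F'\<close> cancel. Each remaining point has mass 1, so
  the distance is at most \<open>(card (F - F') + card (F' - F)) / card F\<close>, and equal sizes
  make the two differences equally large.\<close>

lemma l1_dist_average_sets_le:
  assumes F: "finite F" "finite F'" "card F' = card F"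
    and a: "\<And>h. h \<in> F \<union> F' \<Longrightarrow> a h \<in> simplices S"
  shows "l1_dist (average F a) (average F' a) \<le> 2 * real (card (F' - F)) / real (card F)"
proof -
  let ?T = "\<Union>h\<in>F \<union> F'. {s. a h s \<noteq> 0}"
  have T: "finite ?T" using F simplicesD(3)[OF a] by blast
  have one: "(\<Sum>s\<in>?T. \<Sum>h\<in>D. a h s) = real (card D)" if "D \<subseteq> F \<union> F'" for D
  proof -
    have "(\<Sum>s\<in>?T. \<Sum>h\<in>D. a h s) = (\<Sum>h\<in>D. \<Sum>s\<in>?T. a h s)" by (rule sum.swap)
    also have "\<dots> = (\<Sum>h\<in>D. 1)"
      by (rule sum.cong[OF refl], rule simplicesD(5)[OF a]) (use T that in auto)
    finally show ?thesis by simp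
  qed
  have "l1_dist (average F a) (average F' a) = (\<Sum>s\<in>?T. \<bar>average F a s - average F' a s\<bar>)"
    by (rule l1_dist_eq_sum[OF T]) (blast elim: average_nonzeroD)
  also have "\<dots> \<le> (\<Sum>s\<in>?T. ((\<Sum>h\<in>F - F'. a h s) + (\<Sum>h\<in>F' - F. a h s)) / real (card F))"
  proof (rule sum_mono)
    fix s
    have split: "(\<Sum>h\<in>F. a h s) = (\<Sum>h\<in>F - F'. a h s) + (\<Sum>h\<in>F \<inter> F'. a h s)"
      "(\<Sum>h\<in>F'. a h s) = (\<Sum>h\<in>F' - F. a h s) + (\<Sum>h\<in>F \<inter> F'. a h s)"
      using sum.Int_Diff[OF F(1), of "\<lambda>h. a h s" F'] sum.Int_Diff[OF F(2), of "\<lambda>h. a h s" F]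
      by (simp_all add: Int_commute)
    have eq: "average F a s - average F' a s
        = ((\<Sum>h\<in>F - F'. a h s) - (\<Sum>h\<in>F' - F. a h s)) / real (card F)"
      by (simp add: average_def F(3) split diff_divide_distrib add_divide_distrib)
    have "0 \<le> (\<Sum>h\<in>F - F'. a h s)" "0 \<le> (\<Sum>h\<in>F' - F. a h s)"
      using simplicesD(1)[OF a] by (auto intro!: sum_nonneg)
    then show "\<bar>average F a s - average F' a s\<bar>
        \<le> ((\<Sum>h\<in>F - F'. a h s) + (\<Sum>h\<in>F' - F. a h s)) / real (card F)"
      unfolding eq abs_divide by (simp add: divide_right_mono)
  qed
  also have "\<dots> = (real (card (F - F')) + real (card (F' - F))) / real (card F)"
    unfolding sum_divide_distrib[symmetric] sum.distrib by (subst (1 2) one) auto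
  also have "card (F - F') = card (F' - F)"
    using card_Int_Diff[OF F(1), of F'] card_Int_Diff[OF F(2), of F] F(3)
    by (simp add: Int_commute)
  finally show ?thesis by simp
qed

section \<open>The large scale structure of the quotient\<close>

lemma Un_image_subset_star_set:
  assumes "W \<subseteq> X"
  shows "W \<union> f ` W \<subseteq> star_set W ((\<lambda>x. {x, f x}) ` X)"
proof -
  have "{x, f x} \<subseteq> star_set W ((\<lambda>x. {x, f x}) ` X)" if "x \<in> W" for x
    unfolding star_set_def by (rule Union_upper) (use that assms in auto)
  then show ?thesis by blast
qed

locale coarse_action = Metric_space X d + group_action G X \<alpha>
  for X :: "'a set" and d and G (structure) and \<alpha> +
  assumes coarse: "\<lbrakk>g \<in> carrier G; R > 0\<rbrakk> \<Longrightarrow>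
    \<exists>S>0. \<forall>x\<in>X. \<forall>y\<in>X. d x y \<le> R \<longrightarrow> d (\<alpha> g x) (\<alpha> g y) \<le> S"
begin

sublocale group G
  using group_hom by (rule group_hom.axioms(1))

lemma act_closed [simp]: "g \<in> carrier G \<Longrightarrow> x \<in> X \<Longrightarrow> \<alpha> g x \<in> X"
  using element_image by blast

lemma act_one [simp]: "x \<in> X \<Longrightarrow> \<alpha> \<one> x = x"
  using id_eq_one by (metis restrict_apply')

lemma act_inv [simp]: "g \<in> carrier G \<Longrightarrow> x \<in> X \<Longrightarrow> \<alpha> (inv g) (\<alpha> g x) = x"
  using orbit_sym_aux by blast

lemma act_inv' [simp]: "g \<in> carrier G \<Longrightarrow> x \<in> X \<Longrightarrow> \<alpha> g (\<alpha> (inv g) x) = x"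
  using act_inv[of "inv g" x] by simp

lemma uniformly_coarse:
  assumes "finite F" "F \<subseteq> carrier G"
  shows "\<exists>S. \<forall>g\<in>F. \<forall>x\<in>X. \<forall>y\<in>X. d x y \<le> R \<longrightarrow> d (\<alpha> g x) (\<alpha> g y) \<le> S"
  using assms
proof (induction F rule: finite_induct)
  case (insert g F)
  then obtain S where S: "\<forall>g\<in>F. \<forall>x\<in>X. \<forall>y\<in>X. d x y \<le> R \<longrightarrow> d (\<alpha> g x) (\<alpha> g y) \<le> S" by auto
  \<comment> \<open>\<open>coarse\<close> requires a positive radius, hence
    \<open>max R 1\<close>.\<close>
  obtain S' where S': "\<forall>x\<in>X. \<forall>y\<in>X. d x y \<le> max R 1 \<longrightarrow> d (\<alpha> g x) (\<alpha> g y) \<le> S'"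
    using coarse[of g "max R 1"] insert.prems by (auto simp: less_max_iff_disj)
  have "\<forall>h\<in>insert g F. \<forall>x\<in>X. \<forall>y\<in>X. d x y \<le> R \<longrightarrow> d (\<alpha> h x) (\<alpha> h y) \<le> max S S'"
    using S S' by (simp add: le_max_iff_disj)
  then show ?case by blast
qed simp

text \<open>Closeness up to displacement by a group element from \<open>F\<close>. It need not be
  symmetric, but \<open>near_families\<close> demands it for both orders of two points.\<close>

definition near :: "'b set \<Rightarrow> real \<Rightarrow> 'a \<Rightarrow> 'a \<Rightarrow> bool" where
  "near F R x y \<longleftrightarrow> (\<exists>g\<in>F. d (\<alpha> g x) y \<le> R)"

lemma near_mono: "near F R x y \<Longrightarrow> F \<subseteq> F' \<Longrightarrow> R \<le> R' \<Longrightarrow> near F' R' x y"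
  unfolding near_def by force

text \<open>If \<open>h\<close> moves \<open>x\<close> close to \<open>y\<close> and
  \<open>g\<close> moves \<open>y\<close> close to \<open>z\<close>, then
  \<open>g \<otimes> h\<close> moves \<open>x\<close> close to \<open>z\<close>, because the
  finitely many \<open>g\<close> distort distances by a common bound.\<close>

lemma near_trans:
  assumes "finite F\<^sub>1" "F\<^sub>1 \<subseteq> carrier G" "finite F\<^sub>2" "F\<^sub>2 \<subseteq> carrier G"
  shows "\<exists>F R. finite F \<and> F \<subseteq> carrier G \<and>
    (\<forall>x\<in>X. \<forall>y\<in>X. \<forall>z\<in>X. near F\<^sub>1 R\<^sub>1 x y \<longrightarrow> near F\<^sub>2 R\<^sub>2 y z \<longrightarrow> near F R x z)"
proof -
  obtain S where S: "\<forall>g\<in>F\<^sub>2. \<forall>x\<in>X. \<forall>y\<in>X. d x y \<le> R\<^sub>1 \<longrightarrow> d (\<alpha> g x) (\<alpha> g y) \<le> S"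
    using uniformly_coarse[OF assms(3,4), of R\<^sub>1] by (elim exE)
  let ?F = "(\<lambda>(g, h). g \<otimes> h) ` (F\<^sub>2 \<times> F\<^sub>1)"
  have "near ?F (S + R\<^sub>2) x z"
    if X: "x \<in> X" "y \<in> X" "z \<in> X" and n: "near F\<^sub>1 R\<^sub>1 x y" "near F\<^sub>2 R\<^sub>2 y z" for x y z
  proof -
    obtain h where h: "h \<in> F\<^sub>1" "d (\<alpha> h x) y \<le> R\<^sub>1" using n by (auto simp: near_def)
    obtain g where g: "g \<in> F\<^sub>2" "d (\<alpha> g y) z \<le> R\<^sub>2" using n by (auto simp: near_def)
    have c: "g \<in> carrier G" "h \<in> carrier G" using g h assms by auto
    have "d (\<alpha> (g \<otimes> h) x) z \<le> d (\<alpha> g (\<alpha> h x)) (\<alpha> g y) + d (\<alpha> g y) z"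
      using c X by (simp add: composition_rule triangle)
    also have "\<dots> \<le> S + R\<^sub>2" using S g h c X by (intro add_mono) auto
    finally show ?thesis using g h by (force simp: near_def)
  qed
  moreover have "finite ?F" "?F \<subseteq> carrier G" using assms by auto
  ultimately show ?thesis by blast
qed

text \<open>An explicit structure containing all generators; it bounds the generated structure from
  above.\<close>

definition near_families :: "'a set set set" where
  "near_families = {\<U>. \<U> \<subseteq> Pow X \<and>
     (\<exists>F R. finite F \<and> F \<subseteq> carrier G \<and> (\<forall>U\<in>\<U>. \<forall>x\<in>U. \<forall>y\<in>U. near F R x y))}"

lemma near_familiesI:
  assumes "\<U> \<subseteq> Pow X" "finite F" "F \<subseteq> carrier G"
    "\<And>U x y. U \<in> \<U> \<Longrightarrow> x \<in> U \<Longrightarrow> y \<in> U \<Longrightarrow> near F R x y"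
  shows "\<U> \<in> near_families"
  unfolding near_families_def mem_Collect_eq
proof (intro conjI exI ballI)
  show "near F R x y" if "U \<in> \<U>" "x \<in> U" "y \<in> U" for U x y using that by (rule assms(4))
qed fact+

lemma near_familiesE:
  assumes "\<U> \<in> near_families"
  obtains F R where "\<U> \<subseteq> Pow X" "finite F" "F \<subseteq> carrier G"
    "\<And>U x y. U \<in> \<U> \<Longrightarrow> x \<in> U \<Longrightarrow> y \<in> U \<Longrightarrow> near F R x y"
proof -
  from assms obtain F R where UX: "\<U> \<subseteq> Pow X" and F: "finite F" "F \<subseteq> carrier G"
    and n: "\<forall>U\<in>\<U>. \<forall>x\<in>U. \<forall>y\<in>U. near F R x y"
    unfolding near_families_def mem_Collect_eq by (elim conjE exE)
  show thesis
    by (rule that[OF UX F]) (rule n[THEN bspec, THEN bspec, THEN bspec])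
qed

text \<open>Two points of a star are joined through a member of \<open>\<B>\<^sub>2\<close>, one of
  \<open>\<B>\<^sub>1\<close> and another of \<open>\<B>\<^sub>2\<close>, so two applications of
  \<open>near_trans\<close> give the star axiom.\<close>

lemma large_scale_structure_near_families: "large_scale_structure X near_families"
  unfolding large_scale_structure_def
proof (intro conjI ballI allI impI)
  have "{} \<in> near_families" by (rule near_familiesI[of _ "{}"]) auto
  then show "near_families \<noteq> {}" by blast
next
  fix \<B> assume "\<B> \<in> near_families"
  then show "\<B> \<subseteq> Pow X" by (rule near_familiesE)
next
  fix \<B>\<^sub>1 \<B>\<^sub>2
  assume B: "\<B>\<^sub>1 \<in> near_families" "\<B>\<^sub>2 \<subseteq> Pow X"
    "\<forall>B\<in>\<B>\<^sub>2. (\<exists>x\<in>B. \<exists>y\<in>B. x \<noteq> y) \<longrightarrow> (\<exists>C\<in>\<B>\<^sub>1. B \<subseteq> C)"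
  obtain F R where F: "finite F" "F \<subseteq> carrier G"
    "\<And>U x y. U \<in> \<B>\<^sub>1 \<Longrightarrow> x \<in> U \<Longrightarrow> y \<in> U \<Longrightarrow> near F R x y"
    using near_familiesE[OF B(1)] by metis
  show "\<B>\<^sub>2 \<in> near_families"
  proof (rule near_familiesI[OF B(2)])
    \<comment> \<open>\<open>\<one>\<close> and \<open>max R 0\<close> make every point near itself,
      as needed for one-point members, which may lie in no member of
      \<open>\<B>\<^sub>1\<close>.\<close>
    show "finite (insert \<one> F)" "insert \<one> F \<subseteq> carrier G" using F by auto
    fix U x y assume U: "U \<in> \<B>\<^sub>2" "x \<in> U" "y \<in> U"
    show "near (insert \<one> F) (max R 0) x y"
    proof (cases "x = y")
      case True
      have "x \<in> X" using U B by blast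
      then show ?thesis using True by (simp add: near_def)
    next
      case False
      then obtain C where "C \<in> \<B>\<^sub>1" "U \<subseteq> C" using B U by blast
      then have "near F R x y" using F U by blast
      then show ?thesis by (rule near_mono) auto
    qed
  qed
next
  fix \<B>\<^sub>1 \<B>\<^sub>2 assume B: "\<B>\<^sub>1 \<in> near_families" "\<B>\<^sub>2 \<in> near_families"
  obtain F\<^sub>1 R\<^sub>1 where 1: "\<B>\<^sub>1 \<subseteq> Pow X" "finite F\<^sub>1" "F\<^sub>1 \<subseteq> carrier G"
    "\<And>U x y. U \<in> \<B>\<^sub>1 \<Longrightarrow> x \<in> U \<Longrightarrow> y \<in> U \<Longrightarrow> near F\<^sub>1 R\<^sub>1 x y"
    using near_familiesE[OF B(1)] by metis
  obtain F\<^sub>2 R\<^sub>2 where 2: "\<B>\<^sub>2 \<subseteq> Pow X" "finite F\<^sub>2" "F\<^sub>2 \<subseteq> carrier G"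
    "\<And>U x y. U \<in> \<B>\<^sub>2 \<Longrightarrow> x \<in> U \<Longrightarrow> y \<in> U \<Longrightarrow> near F\<^sub>2 R\<^sub>2 x y"
    using near_familiesE[OF B(2)] by metis
  obtain F R where 3: "finite F" "F \<subseteq> carrier G"
    "\<forall>x\<in>X. \<forall>y\<in>X. \<forall>z\<in>X. near F\<^sub>2 R\<^sub>2 x y \<longrightarrow> near F\<^sub>1 R\<^sub>1 y z \<longrightarrow> near F R x z"
    using near_trans[OF 2(2,3) 1(2,3)] by metis
  obtain F' R' where 4: "finite F'" "F' \<subseteq> carrier G"
    "\<forall>x\<in>X. \<forall>y\<in>X. \<forall>z\<in>X. near F R x y \<longrightarrow> near F\<^sub>2 R\<^sub>2 y z \<longrightarrow> near F' R' x z"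
    using near_trans[OF 3(1,2) 2(2,3)] by metis
  show "star_family \<B>\<^sub>1 \<B>\<^sub>2 \<in> near_families"
  proof (rule near_familiesI[OF _ 4(1,2)])
    show "star_family \<B>\<^sub>1 \<B>\<^sub>2 \<subseteq> Pow X" using 2(1) by (auto simp: star_family_def star_set_def)
    fix W x y assume W: "W \<in> star_family \<B>\<^sub>1 \<B>\<^sub>2" "x \<in> W" "y \<in> W"
    then obtain B U u V v where *: "B \<in> \<B>\<^sub>1" "U \<in> \<B>\<^sub>2" "x \<in> U" "u \<in> U" "u \<in> B"
      "V \<in> \<B>\<^sub>2" "y \<in> V" "v \<in> V" "v \<in> B"
      by (auto simp: star_family_def star_set_def)
    then have "x \<in> X" "u \<in> X" "v \<in> X" "y \<in> X" using 1(1) 2(1) by blast+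
    moreover have "near F\<^sub>2 R\<^sub>2 x u" "near F\<^sub>1 R\<^sub>1 u v" "near F\<^sub>2 R\<^sub>2 v y"
      using * 1(4) 2(4) by blast+
    ultimately show "near F' R' x y" using 3(3) 4(3) by blast
  qed
qed

lemma generators_subset_Pow:
  "metric_lss X d \<union> (\<lambda>g. (\<lambda>x. {x, \<alpha> g x}) ` X) ` carrier G \<subseteq> Pow (Pow X)"
proof (rule Un_least)
  show "metric_lss X d \<subseteq> Pow (Pow X)" by (simp add: metric_lss_def subset_iff)
qed auto

lemma quotient_lss_subset_near_families: "quotient_lss G X d \<alpha> \<subseteq> near_families"
  unfolding quotient_lss_def
proof (rule large_scale_structure_generated_lss(3)[OF generators_subset_Pow
      large_scale_structure_near_families], rule Un_least)
  show "metric_lss X d \<subseteq> near_families"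
  proof
    fix \<U> assume "\<U> \<in> metric_lss X d"
    then obtain R where R: "\<U> \<subseteq> Pow X" "\<forall>U\<in>\<U>. \<forall>x\<in>U. \<forall>y\<in>U. d x y \<le> R"
      unfolding mem_metric_lss_iff by (elim conjE exE)
    show "\<U> \<in> near_families"
    proof (rule near_familiesI[of _ "{\<one>}"])
      fix U x y assume "U \<in> \<U>" "x \<in> U" "y \<in> U"
      moreover from this have "x \<in> X" using R by blast
      ultimately show "near {\<one>} R x y" using R by (simp add: near_def)
    qed (use R in auto)
  qed
  show "(\<lambda>g. (\<lambda>x. {x, \<alpha> g x}) ` X) ` carrier G \<subseteq> near_families"
  proof (rule image_subsetI)
    fix g assume g: "g \<in> carrier G"
    show "(\<lambda>x. {x, \<alpha> g x}) ` X \<in> near_families"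
      \<comment> \<open>\<open>\<one>\<close> serves a point paired with itself, \<open>g\<close>
        and \<open>inv g\<close> serve the two orders of \<open>x\<close> and
        \<open>\<alpha> g x\<close>.\<close>
      by (rule near_familiesI[of _ "{\<one>, g, inv g}" 0]) (use g in \<open>auto simp: near_def\<close>)
  qed
qed

text \<open>Since the pairs \<open>{x, g x}\<close> cover \<open>X\<close>, a star of \<open>W\<close> with respect to them contains both \<open>W\<close> and
  \<open>g W\<close>, so finitely many translates can be collected by iterating stars.\<close>

lemma quotient_lss_translates:
  assumes "\<V> \<in> metric_lss X d" "finite F" "F \<subseteq> carrier G"
  shows "(\<lambda>V. V \<union> (\<Union>g\<in>F. \<alpha> g ` V)) ` \<V> \<in> quotient_lss G X d \<alpha>"
proof -
  note lss = large_scale_structure_generated_lss(1)[OF generators_subset_Pow,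
      folded quotient_lss_def]
  note gen = large_scale_structure_generated_lss(2)[OF generators_subset_Pow,
      folded quotient_lss_def]
  have V: "\<V> \<subseteq> Pow X" using assms(1) by (simp add: mem_metric_lss_iff)
  from assms(2,3) show ?thesis
  proof (induction F rule: finite_induct)
    case empty
    then show ?case using gen assms(1) by auto
  next
    case (insert g F)
    let ?W = "\<lambda>F V. V \<union> (\<Union>g\<in>F. \<alpha> g ` V)" and ?P = "(\<lambda>x. {x, \<alpha> g x}) ` X"
    have g: "g \<in> carrier G" and F: "F \<subseteq> carrier G" using insert.prems by auto
    have "?P \<in> quotient_lss G X d \<alpha>" using gen g by blast
    then have star: "star_family (?W F ` \<V>) ?P \<in> quotient_lss G X d \<alpha>"
      using insert.IH[OF F] large_scale_structureD(3)[OF lss] by blast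
    show ?case
    proof (rule large_scale_structureD(2)[OF lss star], goal_cases)
      case 1
      show ?case using V insert.prems by (auto simp: subset_iff)
    next
      case 2
      have "?W (insert g F) V \<subseteq> star_set (?W F V) ?P" if "V \<in> \<V>" for V
      proof -
        have "V \<subseteq> X" using V that by blast
        then have "?W F V \<subseteq> X" using F by (auto simp: subset_iff)
        from Un_image_subset_star_set[OF this] show ?thesis by blast
      qed
      then show ?case
        unfolding star_family_def ball_simps
        by (intro ballI impI) (rule bexI, assumption, rule imageI, rule imageI, assumption)
    qed
  qed
qed


section \<open>The averaged partition of unity\<close>

lemma property_A_quotient_lss:
  assumes am: "amenable G" and A: "property_A X (metric_lss X d)"
  shows "property_A X (quotient_lss G X d \<alpha>)"
  unfolding exact_def
proof (intro allI impI)
  fix \<U> :: "'a set set" and \<epsilon> :: real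
  assume cov: "uniformly_bounded_cover X (quotient_lss G X d \<alpha>) \<U>" and \<epsilon>: "\<epsilon> > 0"
  have "\<U> \<in> near_families"
    using cov quotient_lss_subset_near_families by (auto simp: uniformly_bounded_cover_def)
  then obtain E R where U: "\<U> \<subseteq> Pow X" and E: "finite E" "E \<subseteq> carrier G"
    and near: "\<And>U x y. U \<in> \<U> \<Longrightarrow> x \<in> U \<Longrightarrow> y \<in> U \<Longrightarrow> near E R x y"
    using near_familiesE by metis
  have E': "finite (m_inv G ` E)" "m_inv G ` E \<subseteq> carrier G" using E by auto
  \<comment> \<open>Inverses of \<open>E\<close> occur because moving \<open>x\<close> by
    \<open>g\<close> translates the index set of the average by \<open>inv g\<close>. The factor 2
    in \<open>l1_dist_average_sets_le\<close> turns \<open>\<epsilon> / 8\<close> into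
    \<open>\<epsilon> / 4\<close>.\<close>
  obtain F where F: "finite F" "F \<noteq> {}" "F \<subseteq> carrier G"
    and folner: "\<forall>g\<in>m_inv G ` E. real (card ((g <#\<^bsub>G\<^esub> F) - F)) \<le> \<epsilon> / 8 * real (card F)"
    using amenable_folner[OF am E', of "\<epsilon> / 8"] \<epsilon> by auto
  have n: "real (card F) > 0" using F by (simp add: card_gt_0_iff)
  obtain T where T: "\<forall>g\<in>m_inv G ` F. \<forall>x\<in>X. \<forall>y\<in>X. d x y \<le> R \<longrightarrow> d (\<alpha> g x) (\<alpha> g y) \<le> T"
    using uniformly_coarse[of "m_inv G ` F" R] F by auto
  \<comment> \<open>\<open>T\<close> could be negative if no two points are \<open>R\<close>-close;
    \<open>max T 0\<close> keeps each centre in its ball, so the balls cover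
    \<open>X\<close>.\<close>
  define \<B> where "\<B> = (\<lambda>x. {y \<in> X. d x y \<le> max T 0}) ` X"
  have "uniformly_bounded_cover X (metric_lss X d) \<B>"
    unfolding uniformly_bounded_cover_def mem_metric_lss_iff
  proof (intro conjI exI ballI)
    show "\<Union>\<B> = X" by (force simp: \<B>_def)
    fix B y z assume "B \<in> \<B>" "y \<in> B" "z \<in> B"
    then obtain x where "x \<in> X" "y \<in> X" "z \<in> X" "d x y \<le> max T 0" "d x z \<le> max T 0"
      by (auto simp: \<B>_def)
    moreover from this have "d y z \<le> d x y + d x z" by (metis triangle commute)
    ultimately show "d y z \<le> max T 0 + max T 0" by linarith
  qed (auto simp: \<B>_def)
  then obtain S :: "('a \<times> nat) set" and \<psi> where
    part: "exact_partition X (metric_lss X d) \<B> (\<epsilon> / 4) S \<psi>"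
    using A \<epsilon> unfolding exact_def by (meson zero_less_divide_iff zero_less_numeral)
  have \<psi>: "\<psi> x \<in> simplices S" if "x \<in> X" for x
    using part that by (auto simp: exact_partition_def)
  have close: "l1_dist (\<psi> x) (\<psi> y) < \<epsilon> / 4" if "x \<in> X" "y \<in> X" "d x y \<le> T" for x y
  proof (rule SUP_ediam_lessD)
    show "(SUP U\<in>\<B>. ediam l1_dist (\<psi> ` U)) < ennreal (\<epsilon> / 4)"
      using part by (simp add: exact_partition_def)
    show "{y \<in> X. d x y \<le> max T 0} \<in> \<B>" using that by (auto simp: \<B>_def)
  qed (use that in auto)
  define \<phi> where "\<phi> x = average F (\<lambda>h. \<psi> (\<alpha> (inv h) x))" for x
  have Fc: "h \<in> carrier G" if "h \<in> F" for h using that F by auto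
  have \<phi>: "\<phi> x \<in> simplices S" if "x \<in> X" for x
    unfolding \<phi>_def by (rule average_simplices) (use F Fc that \<psi> in auto)
  have translate: "l1_dist (\<phi> x) (\<phi> (\<alpha> g x)) \<le> \<epsilon> / 4" if g: "g \<in> E" and x: "x \<in> X" for g x
  proof -
    let ?F = "inv g <#\<^bsub>G\<^esub> F"
    have gc: "g \<in> carrier G" using g E by auto
    have F': "?F = (\<lambda>h. inv g \<otimes> h) ` F" by (auto simp: l_coset_def)
    have inj: "inj_on (\<lambda>h. inv g \<otimes> h) F" using gc Fc by (auto intro!: inj_onI)
    have card: "card ?F = card F" unfolding F' by (rule card_image[OF inj])
    have "\<phi> (\<alpha> g x) = average ?F (\<lambda>h. \<psi> (\<alpha> (inv h) x))"
    proof
      fix s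
      \<comment> \<open>Since \<open>inv h \<otimes> g\<close> is the inverse of
        \<open>inv g \<otimes> h\<close>, the average at \<open>\<alpha> g x\<close> is the average
        at \<open>x\<close> over a translate of \<open>F\<close>.\<close>
      have "(\<Sum>h\<in>F. \<psi> (\<alpha> (inv h) (\<alpha> g x)) s) = (\<Sum>h\<in>F. \<psi> (\<alpha> (inv (inv g \<otimes> h)) x) s)"
        by (rule sum.cong) (use gc Fc x in \<open>simp_all add: inv_mult_group composition_rule\<close>)
      then show "\<phi> (\<alpha> g x) s = average ?F (\<lambda>h. \<psi> (\<alpha> (inv h) x)) s"
        unfolding \<phi>_def average_def card unfolding F' by (simp add: sum.reindex[OF inj])
    qed
    then have "l1_dist (\<phi> x) (\<phi> (\<alpha> g x))
        = l1_dist (average F (\<lambda>h. \<psi> (\<alpha> (inv h) x))) (average ?F (\<lambda>h. \<psi> (\<alpha> (inv h) x)))"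
      by (simp add: \<phi>_def)
    also have "\<dots> \<le> 2 * real (card (?F - F)) / real (card F)"
    proof (rule l1_dist_average_sets_le[OF F(1) _ card])
      show "finite ?F" unfolding F' using F by simp
      show "\<psi> (\<alpha> (inv h) x) \<in> simplices S" if "h \<in> F \<union> ?F" for h
        using that Fc gc x unfolding F' by (auto intro!: \<psi>)
    qed
    also have "\<dots> \<le> 2 * (\<epsilon> / 8 * real (card F)) / real (card F)"
      using folner g by (intro divide_right_mono mult_left_mono) auto
    also have "\<dots> = \<epsilon> / 4" using n by simp
    finally show ?thesis .
  qed
  have nearby: "l1_dist (\<phi> x) (\<phi> y) \<le> \<epsilon> / 4" if x: "x \<in> X" "y \<in> X" "d x y \<le> R" for x y
  proof -
    have "l1_dist (\<phi> x) (\<phi> y)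
        \<le> (\<Sum>h\<in>F. l1_dist (\<psi> (\<alpha> (inv h) x)) (\<psi> (\<alpha> (inv h) y))) / real (card F)"
      unfolding \<phi>_def by (rule l1_dist_average_le[OF F(1), where S = S]) (use Fc x \<psi> in auto)
    also have "\<dots> \<le> (\<Sum>h\<in>F. \<epsilon> / 4) / real (card F)"
    proof (intro divide_right_mono sum_mono)
      fix h assume h: "h \<in> F"
      then have "d (\<alpha> (inv h) x) (\<alpha> (inv h) y) \<le> T" using T x by blast
      then show "l1_dist (\<psi> (\<alpha> (inv h) x)) (\<psi> (\<alpha> (inv h) y)) \<le> \<epsilon> / 4"
        using close Fc[OF h] x by (simp add: less_imp_le)
    qed simp
    also have "\<dots> = \<epsilon> / 4" using n by simp
    finally show ?thesis .
  qed
  have var: "l1_dist (\<phi> x) (\<phi> y) \<le> \<epsilon> / 2" if V: "V \<in> \<U>" "x \<in> V" "y \<in> V" for V x y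
  proof -
    have X: "x \<in> X" "y \<in> X" using U V by auto
    obtain g where g: "g \<in> E" "d (\<alpha> g x) y \<le> R" using near[OF V] by (auto simp: near_def)
    then have gx: "\<alpha> g x \<in> X" using E X by auto
    \<comment> \<open>The first leg is controlled by almost invariance of \<open>F\<close>, the
      second by the small variation of \<open>\<psi>\<close>. The total
      \<open>\<epsilon> / 2\<close> keeps the supremum strictly below
      \<open>\<epsilon>\<close>.\<close>
    have "l1_dist (\<phi> x) (\<phi> y) \<le> l1_dist (\<phi> x) (\<phi> (\<alpha> g x)) + l1_dist (\<phi> (\<alpha> g x)) (\<phi> y)"
      by (intro l1_dist_triangle simplicesD(3)[OF \<phi>] X gx)
    also have "\<dots> \<le> \<epsilon> / 4 + \<epsilon> / 4"
      by (intro add_mono translate nearby X gx g)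
    finally show ?thesis by simp
  qed
  let ?star = "\<lambda>s. {x \<in> X. \<phi> x \<in> vertex_star S s}"
  let ?st = "\<lambda>s. {x \<in> X. \<psi> x \<in> vertex_star S s}"
  note lss = large_scale_structure_generated_lss(1)[OF generators_subset_Pow,
      folded quotient_lss_def]
  have "?st ` S \<in> metric_lss X d"
    using part by (simp add: exact_partition_def uniformly_bounded_cover_def)
  from quotient_lss_translates[OF this F(1,3)]
  have "?star ` S \<in> quotient_lss G X d \<alpha>"
  proof (rule large_scale_structureD(2)[OF lss])
    show "?star ` S \<subseteq> Pow X" by auto
    \<comment> \<open>A nonzero average has a nonzero summand, say at \<open>h\<close>; then
      \<open>\<alpha> (inv h) x\<close> lies in the star of \<open>\<psi>\<close>, and
      \<open>x\<close> in its translate by \<open>h\<close>.\<close>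
    have "?star s \<subseteq> ?st s \<union> (\<Union>g\<in>F. \<alpha> g ` ?st s)" for s
    proof
      fix x assume "x \<in> ?star s"
      then have x: "x \<in> X" "\<phi> x s \<noteq> 0" by (auto simp: vertex_star_def)
      then obtain h where h: "h \<in> F" "\<psi> (\<alpha> (inv h) x) s \<noteq> 0"
        unfolding \<phi>_def by (elim average_nonzeroD)
      then have "\<alpha> (inv h) x \<in> ?st s" using x Fc \<psi> by (simp add: vertex_star_def)
      moreover have "x = \<alpha> h (\<alpha> (inv h) x)" using x Fc h by simp
      ultimately show "x \<in> ?st s \<union> (\<Union>g\<in>F. \<alpha> g ` ?st s)" using h(1) by blast
    qed
    then show "\<forall>B\<in>?star ` S. (\<exists>x\<in>B. \<exists>y\<in>B. x \<noteq> y) \<longrightarrow>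
        (\<exists>C\<in>(\<lambda>V. V \<union> (\<Union>g\<in>F. \<alpha> g ` V)) ` ?st ` S. B \<subseteq> C)"
      unfolding ball_simps
      by (intro ballI impI) (rule bexI, assumption, rule imageI, rule imageI, assumption)
  qed
  moreover have "\<Union>(?star ` S) = X"
  proof
    show "X \<subseteq> \<Union>(?star ` S)"
    proof
      fix x assume x: "x \<in> X"
      have "(\<Sum>s | \<phi> x s \<noteq> 0. \<phi> x s) = 1"
        using \<phi>[OF x] by (simp add: simplices_def)
      then obtain s where s: "\<phi> x s \<noteq> 0" by (metis sum.neutral zero_neq_one)
      have "x \<in> ?star s" using x \<phi>[OF x] s by (simp add: vertex_star_def)
      moreover have "s \<in> S" using simplicesD(4)[OF \<phi>[OF x] s] .
      ultimately show "x \<in> \<Union>(?star ` S)" by blast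
    qed
  qed auto
  moreover have "(SUP V\<in>\<U>. ediam l1_dist (\<phi> ` V)) < ennreal \<epsilon>"
  proof -
    have "(SUP V\<in>\<U>. ediam l1_dist (\<phi> ` V)) \<le> ennreal (\<epsilon> / 2)"
      unfolding ediam_def image_image by (intro SUP_least ennreal_leI var)
    also have "\<dots> < ennreal \<epsilon>" using \<epsilon> by (simp add: ennreal_less_iff)
    finally show ?thesis .
  qed
  ultimately have "exact_partition X (quotient_lss G X d \<alpha>) \<U> \<epsilon> S \<phi>"
    using \<phi> by (simp add: exact_partition_def uniformly_bounded_cover_def)
  then show "\<exists>(S :: ('a \<times> nat) set) \<phi>. exact_partition X (quotient_lss G X d \<alpha>) \<U> \<epsilon> S \<phi>"
    by blast
qed

end

theorem theorem5p6:
  fixes G :: "('g, 'm) monoid_scheme"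
    and X :: "'a set"
    and d :: "'a \<Rightarrow> 'a \<Rightarrow> real"
    and \<alpha> :: "'g \<Rightarrow> 'a \<Rightarrow> 'a"
  assumes "group G" and "countable (carrier G)"
    and "discrete_metric_space X d" and "bounded_geometry X d"
    and "acts_by_coarse_equivalences G X d \<alpha>"
    and "amenable G"
    and "property_A X (metric_lss X d)"
  shows "property_A X (quotient_lss G X d \<alpha>)"
proof -
  interpret coarse_action X d G \<alpha>
    using assms(3,5)
    by (intro coarse_action.intro coarse_action_axioms.intro)
      (simp_all add: discrete_metric_space_def acts_by_coarse_equivalences_def)
  show ?thesis using assms(6,7) by (rule property_A_quotient_lss)
qed

end
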